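(* For all natural numbers $m<n$, one has $QL(\mathbb{C}^n) \subsetneq QL(\mathbb{C}^m)$; that is, every formula that is a tautology in $\mathbb{C}^n$ is a tautology in $\mathbb{C}^m$, and there is a formula that is a tautology in $\mathbb{C}^m$ but not in $\mathbb{C}^n$.
   Context: Propositional formulas are built from variable symbols, parentheses, the binary connectives $\land$ (meet) and $\lor$ (join), the unary connective $\lnot$ (orthocomplement), and the constants $\top$ and $\bot$; the well-formed formulas are those of Boolean propositional logic. Given a finite dimensional Hilbert space $U$ and a formula $\phi(v_1,\dots,v_k)$ together with subspaces $S_1,\dots,S_k$ of $U$, the valuation $\Xi_U(\phi,S_1,\dots,S_k)$ is the subspace of $U$ obtained by substituting $S_i$ for $v_i$, interpreting $\top$ as $U$, $\bot$ as the zero subspace, $\land$ as intersection, $\lor$ as the span of the union, and $\lnot$ as orthogonal complement in $U$. For a formula $\phi$, define $\bar d_\phi:\mathbb{N}\to\mathbb{N}$ by $\bar d_\phi(n)=\max_{S_1,\dots,S_k}\dim \Xi_{\mathbb{C}^n}(\phi,S_1,\dots,S_k)$, the maximum over all tuples of subspaces of $\mathbb{C}^n$. A formula $\phi$ is a tautology in $\mathbb{C}^n$ if $\bar d_\phi(n)=0$, and $QL(\mathbb{C}^n)$ denotes the set of formulas that are tautologies in $\mathbb{C}^n$. *)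

theory Defs
  imports Complex_Main "Jordan_Normal_Form.VS_Connect"
begin

datatype formula =
    Var nat
  | Top
  | Bot
  | Neg formula
  | Meet formula formula
  | Join formula formula

abbreviation Cn :: "nat \<Rightarrow> (complex, complex vec) module" where
  "Cn n \<equiv> module_vec TYPE(complex) n"

definition subspaces :: "nat \<Rightarrow> complex vec set set" where
  "subspaces n = {W. VectorSpace.subspace class_ring W (Cn n)}"

definition subspace_dim :: "nat \<Rightarrow> complex vec set \<Rightarrow> nat" where
  "subspace_dim n W = vectorspace.dim class_ring (Cn n\<lparr>carrier := W\<rparr>)"

text \<open>The library's \<open>orthogonal_complement\<close> uses the bilinear product; here the Hermitian one is needed.\<close>

definition orthocomplement :: "nat \<Rightarrow> complex vec set \<Rightarrow> complex vec set" where
  "orthocomplement n W = {v \<in> carrier_vec n. \<forall>w\<in>W. v \<bullet>c w = 0}"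

fun valuation :: "nat \<Rightarrow> formula \<Rightarrow> (nat \<Rightarrow> complex vec set) \<Rightarrow> complex vec set" where
  "valuation n (Var i) S = S i"
| "valuation n Top S = carrier_vec n"
| "valuation n Bot S = {0\<^sub>v n}"
| "valuation n (Neg \<phi>) S = orthocomplement n (valuation n \<phi> S)"
| "valuation n (Meet \<phi> \<psi>) S = valuation n \<phi> S \<inter> valuation n \<psi> S"
| "valuation n (Join \<phi> \<psi>) S =
     LinearCombinations.module.span class_ring (Cn n) (valuation n \<phi> S \<union> valuation n \<psi> S)"

text \<open>A tuple of subspaces for the variables of \<open>\<phi>\<close> is given by an assignment of subspaces to
  all variables; the values at variables not occurring in \<open>\<phi>\<close> are irrelevant. The set
  under \<open>Max\<close> is nonempty and bounded by \<open>n\<close>.\<close>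

definition max_dim :: "formula \<Rightarrow> nat \<Rightarrow> nat" where
  "max_dim \<phi> n = Max {subspace_dim n (valuation n \<phi> S) | S. \<forall>i. S i \<in> subspaces n}"

text \<open>Tautologies are the formulas whose maximal dimension is 0 (not those that always
  evaluate to the whole space).\<close>

definition tautology_in :: "formula \<Rightarrow> nat \<Rightarrow> bool" where
  "tautology_in \<phi> n \<longleftrightarrow> max_dim \<phi> n = 0"

definition QL :: "nat \<Rightarrow> formula set" where
  "QL n = {\<phi>. tautology_in \<phi> n}"

end

theory Submission
  imports Defs
begin

text \<open>
  Valuation commutes with orthogonal direct sums: at \<open>S\<^sub>i \<oplus> T\<^sub>i\<close> in \<open>\<complex>\<^sup>m \<oplus> \<complex>\<^sup>k\<close> a formula evaluates to
  the direct sum of its values at \<open>S\<close> and at \<open>T\<close>. So a nonzero value in \<open>\<complex>\<^sup>m\<close> yields one in every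
  larger space.

  For strictness, consider \<open>x \<and> (\<not>x \<or> w\<^sub>0) \<and> \<dots> \<and> (\<not>x \<or> w\<^bsub>n-1\<^esub>)\<close>, where
  \<open>w\<^sub>i = v\<^sub>i \<and> \<not>v\<^sub>0 \<and> \<dots> \<and> \<not>v\<^bsub>i-1\<^esub>\<close> are pairwise orthogonal. If some \<open>w\<^sub>i\<close> is zero, the value lies in
  \<open>x \<and> \<not>x\<close> and is zero; hence a nonzero value requires \<open>n\<close> pairwise orthogonal nonzero vectors. In
  \<open>\<complex>\<^sup>n\<close> a nonzero value is attained with \<open>v\<^sub>i\<close> spanned by the unit vector \<open>e\<^sub>i\<close> and \<open>x\<close> spanned by
  \<open>s = e\<^sub>0 + \<dots> + e\<^bsub>n-1\<^esub>\<close>, since \<open>s - n e\<^sub>i\<close> is orthogonal to \<open>s\<close>.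
\<close>

section \<open>Subspaces and valuations\<close>

text \<open>Elementwise closure conditions, the working form of the locale predicate in all later
  membership arguments.\<close>

lemma mem_subspaces_iff:
  "W \<in> subspaces n \<longleftrightarrow> W \<subseteq> carrier_vec n \<and> 0\<^sub>v n \<in> W \<and>
    (\<forall>v\<in>W. \<forall>w\<in>W. v + w \<in> W) \<and> (\<forall>c. \<forall>v\<in>W. c \<cdot>\<^sub>v v \<in> W)"
proof -
  have "W \<in> subspaces n \<longleftrightarrow> submodule class_ring W (Cn n)"
    by (simp add: subspaces_def VectorSpace.subspace_def vec_vs)
  also have "\<dots> \<longleftrightarrow> W \<subseteq> carrier_vec n \<and> 0\<^sub>v n \<in> W \<and>
    (\<forall>v\<in>W. \<forall>w\<in>W. v + w \<in> W) \<and> (\<forall>c. \<forall>v\<in>W. c \<cdot>\<^sub>v v \<in> W)"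
    by (auto simp: submodule_def vec_module module_vec_simps)
  finally show ?thesis .
qed

lemma subspaces_imp_submodule:
  "W \<in> subspaces n \<Longrightarrow> submodule class_ring W (Cn n)"
  by (simp add: subspaces_def VectorSpace.subspace_def)

text \<open>Independence inside \<open>W\<close> agrees with independence in C^n, so independent
  subsets of \<open>W\<close> have at most \<open>n\<close> elements. A maximal one therefore exists
  and is a basis, and its cardinality is the dimension.\<close>

lemma
  assumes W: "W \<in> subspaces n"
  shows subspace_dim_le: "subspace_dim n W \<le> n"
    and subspace_dim_eq_0_iff: "subspace_dim n W = 0 \<longleftrightarrow> W = {0\<^sub>v n}"
proof -
  interpret V: vec_space "TYPE(complex)" n .
  note sub = subspaces_imp_submodule[OF W]
  interpret W: vectorspace class_ring "Cn n\<lparr>carrier := W\<rparr>"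
    by (rule V.subspace_is_vs) (use W in \<open>simp add: subspaces_def\<close>)
  have WV: "W \<subseteq> carrier_vec n" using W by (simp add: mem_subspaces_iff)
  have small: "finite A \<and> card A \<le> n" if "A \<subseteq> W \<and> W.lin_indpt A" for A
  proof -
    have "V.lin_indpt A" using V.span_li_not_depend(2)[OF _ sub, of A] that by simp
    then show ?thesis using V.li_le_dim[of A] that WV V.dim_is_n by auto
  qed
  have "W.lin_indpt {}" by (rule W.finite_lin_indpt2) auto
  then obtain A where A: "finite A" "maximal A (\<lambda>A. A \<subseteq> W \<and> W.lin_indpt A)"
    using maximal_exists[of "\<lambda>A. A \<subseteq> W \<and> W.lin_indpt A" n "{}"] small by auto
  then have basis: "W.basis A" by (intro W.max_li_is_basis) simp
  have dim: "subspace_dim n W = card A"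
    unfolding subspace_dim_def by (rule W.dim_basis[OF A(1) basis])
  show "subspace_dim n W \<le> n" using A small[of A] by (auto simp: dim maximal_def)
  have span: "V.span A = W" and li: "V.lin_indpt A" and AW: "A \<subseteq> W"
    using basis V.span_li_not_depend[OF _ sub, of A] by (auto simp: W.basis_def)
  show "subspace_dim n W = 0 \<longleftrightarrow> W = {0\<^sub>v n}"
  proof
    assume "subspace_dim n W = 0"
    then have "A = {}" using dim A(1) by simp
    then show "W = {0\<^sub>v n}" using span V.span_empty by simp
  next
    assume W0: "W = {0\<^sub>v n}"
    \<comment> \<open>Over a nontrivial scalar field an independent set omits the zero vector, so a
      basis of the zero subspace is empty.\<close>
    have "(UNIV :: complex set) \<noteq> {0}" by (metis UNIV_I singletonD zero_neq_one)
    then have "0\<^sub>v n \<notin> A" using V.zero_nin_lin_indpt[OF _ li] AW WV by auto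
    then have "A = {}" using AW W0 by auto
    then show "subspace_dim n W = 0" by (simp add: dim)
  qed
qed

text \<open>The span of a union is the sum of the spans, and a subspace is its own span. Joins can
  thus be handled through decompositions into two vectors.\<close>

lemma span_Un_subspaces:
  assumes A: "A \<in> subspaces n" and B: "B \<in> subspaces n"
  shows "LinearCombinations.module.span class_ring (Cn n) (A \<union> B) = {a + b | a b. a \<in> A \<and> b \<in> B}"
proof -
  interpret V: vec_space "TYPE(complex)" n .
  have car: "A \<subseteq> carrier_vec n" "B \<subseteq> carrier_vec n" using A B by (auto simp: mem_subspaces_iff)
  have "V.span X = X" if "X \<in> subspaces n" for X
    using V.span_is_subset[OF subset_refl subspaces_imp_submodule[OF that]]
      V.in_own_span[of X] that by (auto simp: mem_subspaces_iff)
  then have "V.span (A \<union> B) = V.submodule_sum A B"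
    using V.span_union_is_sum[of A B] A B car by simp
  then show ?thesis by (auto simp: V.submodule_sum_def)
qed

lemma orthocomplement_in_subspaces:
  assumes "W \<subseteq> carrier_vec n"
  shows "orthocomplement n W \<in> subspaces n"
  using assms
  by (auto simp: mem_subspaces_iff orthocomplement_def subset_iff
      add_scalar_prod_distrib[where n=n])

lemma valuation_in_subspaces:
  assumes "\<And>i. S i \<in> subspaces n"
  shows "valuation n \<phi> S \<in> subspaces n"
proof (induction \<phi>)
  case (Neg \<phi>)
  then have "valuation n \<phi> S \<subseteq> carrier_vec n" by (simp add: mem_subspaces_iff)
  then show ?case by (simp add: orthocomplement_in_subspaces)
next
  case (Join \<phi> \<psi>)
  interpret V: vec_space "TYPE(complex)" n .
  have "valuation n \<phi> S \<union> valuation n \<psi> S \<subseteq> carrier_vec n"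
    using Join by (auto simp: mem_subspaces_iff)
  then show ?case using V.span_is_subspace by (simp add: subspaces_def)
qed (use assms in \<open>auto simp: mem_subspaces_iff\<close>)

text \<open>The dimensions are bounded by \<open>n\<close> and some assignment exists, so
  \<open>Max\<close> ranges over a finite nonempty set and vanishes exactly when all its members do.
  From here on the argument concerns zero and nonzero values instead of maximal dimensions.\<close>

lemma tautology_in_iff:
  "tautology_in \<phi> n \<longleftrightarrow> (\<forall>S. (\<forall>i. S i \<in> subspaces n) \<longrightarrow> valuation n \<phi> S = {0\<^sub>v n})"
proof -
  let ?D = "{subspace_dim n (valuation n \<phi> S) | S. \<forall>i. S i \<in> subspaces n}"
  have "?D \<subseteq> {..n}" by (auto intro!: subspace_dim_le valuation_in_subspaces)
  then have fin: "finite ?D" by (rule finite_subset) simp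
  have "carrier_vec n \<in> subspaces n" by (auto simp: mem_subspaces_iff)
  then have "?D \<noteq> {}" by (auto intro!: exI[of _ "\<lambda>_. carrier_vec n"])
  then have "Max ?D = 0 \<longleftrightarrow> (\<forall>d\<in>?D. d = 0)" using fin
    by (metis (no_types, lifting) Max_ge Max_in le_zero_eq)
  also have "\<dots> \<longleftrightarrow> (\<forall>S. (\<forall>i. S i \<in> subspaces n) \<longrightarrow> subspace_dim n (valuation n \<phi> S) = 0)"
    by (auto simp only: mem_Collect_eq)
  also have "\<dots> \<longleftrightarrow> (\<forall>S. (\<forall>i. S i \<in> subspaces n) \<longrightarrow> valuation n \<phi> S = {0\<^sub>v n})"
    by (simp add: subspace_dim_eq_0_iff valuation_in_subspaces)
  finally show ?thesis by (simp add: tautology_in_def max_dim_def)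
qed

lemma not_tautology_inI:
  assumes "\<And>i. S i \<in> subspaces n" "v \<in> valuation n \<phi> S" "v \<noteq> 0\<^sub>v n"
  shows "\<not> tautology_in \<phi> n"
  using assms unfolding tautology_in_iff by blast

lemma not_tautology_inE:
  assumes "\<not> tautology_in \<phi> n"
  obtains S v where "\<forall>i. S i \<in> subspaces n" "v \<in> valuation n \<phi> S" "v \<noteq> 0\<^sub>v n"
proof -
  obtain S where S: "\<forall>i. S i \<in> subspaces n" "valuation n \<phi> S \<noteq> {0\<^sub>v n}"
    using assms by (auto simp: tautology_in_iff)
  then have "0\<^sub>v n \<in> valuation n \<phi> S"
    using valuation_in_subspaces[of S n \<phi>] by (simp add: mem_subspaces_iff)
  then show ?thesis using S that by blast
qed


section \<open>Orthogonal direct sums\<close>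

text \<open>Concatenation identifies pairs from C^m and C^k with vectors of C^(m+k), where the two
  blocks are orthogonal.\<close>

definition vec_sum :: "complex vec set \<Rightarrow> complex vec set \<Rightarrow> complex vec set" where
  "vec_sum A B = {a @\<^sub>v b | a b. a \<in> A \<and> b \<in> B}"

lemma vec_sumI: "a \<in> A \<Longrightarrow> b \<in> B \<Longrightarrow> a @\<^sub>v b \<in> vec_sum A B"
  by (auto simp: vec_sum_def)

lemma cscalar_prod_append:
  fixes v w a b :: "complex vec"
  assumes "v \<in> carrier_vec m" "a \<in> carrier_vec m" "w \<in> carrier_vec k" "b \<in> carrier_vec k"
  shows "(v @\<^sub>v w) \<bullet>c (a @\<^sub>v b) = v \<bullet>c a + w \<bullet>c b"
proof -
  have "conjugate (a @\<^sub>v b) = conjugate a @\<^sub>v conjugate b" by (rule eq_vecI) auto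
  then show ?thesis using assms by (simp add: scalar_prod_append[where ?n1.0 = m and ?n2.0 = k])
qed

lemma smult_append_vec: "c \<cdot>\<^sub>v (v @\<^sub>v w) = (c \<cdot>\<^sub>v v) @\<^sub>v (c \<cdot>\<^sub>v w)"
  by (rule eq_vecI) auto

lemma append_vec_cases:
  assumes "v \<in> carrier_vec (m + k)"
  obtains x y where "v = x @\<^sub>v y" "x \<in> carrier_vec m" "y \<in> carrier_vec k"
  using that[OF vec_first_last_append[OF assms, symmetric]] by simp

lemma vec_sum_carrier: "vec_sum (carrier_vec m) (carrier_vec k) = carrier_vec (m + k)"
  by (auto simp: vec_sum_def elim!: append_vec_cases)

lemma vec_sum_zero: "vec_sum {0\<^sub>v m} {0\<^sub>v k} = {0\<^sub>v (m + k)}"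
proof -
  have "0\<^sub>v m @\<^sub>v 0\<^sub>v k = (0\<^sub>v (m + k) :: complex vec)" by (rule eq_vecI) auto
  then show ?thesis by (auto simp: vec_sum_def)
qed

lemma vec_sum_in_subspaces:
  assumes "A \<in> subspaces m" "B \<in> subspaces k"
  shows "vec_sum A B \<in> subspaces (m + k)"
proof -
  have "0\<^sub>v (m + k) \<in> vec_sum {0\<^sub>v m} {0\<^sub>v k}" by (simp add: vec_sum_zero)
  then have "0\<^sub>v (m + k) \<in> vec_sum A B"
    using assms by (auto simp: vec_sum_def mem_subspaces_iff)
  moreover have "vec_sum A B \<subseteq> carrier_vec (m + k)"
    using assms by (auto simp: vec_sum_def mem_subspaces_iff)
  moreover have "v + w \<in> vec_sum A B" if vw: "v \<in> vec_sum A B" "w \<in> vec_sum A B" for v w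
  proof -
    obtain a b c d where "v = a @\<^sub>v b" "w = c @\<^sub>v d" "a \<in> A" "c \<in> A" "b \<in> B" "d \<in> B"
      using vw by (auto simp: vec_sum_def)
    moreover from this have "v + w = (a + c) @\<^sub>v (b + d)"
      using assms append_vec_add[of a m c b k d] by (auto simp: mem_subspaces_iff)
    ultimately show ?thesis using assms by (auto simp: mem_subspaces_iff intro!: vec_sumI)
  qed
  moreover have "c \<cdot>\<^sub>v v \<in> vec_sum A B" if v: "v \<in> vec_sum A B" for c v
  proof -
    obtain a b where "v = a @\<^sub>v b" "a \<in> A" "b \<in> B" using v by (auto simp: vec_sum_def)
    then show ?thesis
      using assms by (auto simp: mem_subspaces_iff smult_append_vec intro!: vec_sumI)
  qed
  ultimately show ?thesis by (simp add: mem_subspaces_iff)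
qed

text \<open>Concatenations whose first blocks have the same length \<open>m\<close> are equal only
  blockwise, so a common vector has the same two blocks in both sums.\<close>

lemma vec_sum_Int:
  assumes "A \<in> subspaces m" "A' \<in> subspaces m"
  shows "vec_sum A B \<inter> vec_sum A' B' = vec_sum (A \<inter> A') (B \<inter> B')"
proof -
  have "a = a' \<and> b = b'" if "a @\<^sub>v b = a' @\<^sub>v b'" "a \<in> A" "a' \<in> A'" for a b a' b'
    using append_vec_eq[of a m a' b b'] that assms by (auto simp: mem_subspaces_iff)
  then have "v \<in> vec_sum (A \<inter> A') (B \<inter> B')" if "v \<in> vec_sum A B" "v \<in> vec_sum A' B'" for v
    using that unfolding vec_sum_def by blast
  moreover have "vec_sum (A \<inter> A') (B \<inter> B') \<subseteq> vec_sum A B \<inter> vec_sum A' B'"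
    unfolding vec_sum_def by blast
  ultimately show ?thesis by blast
qed

lemma orthocomplement_vec_sum:
  assumes A: "A \<in> subspaces m" and B: "B \<in> subspaces k"
  shows "orthocomplement (m + k) (vec_sum A B) =
    vec_sum (orthocomplement m A) (orthocomplement k B)"
proof (intro equalityI subsetI)
  fix v assume v: "v \<in> orthocomplement (m + k) (vec_sum A B)"
  then obtain x y where xy: "v = x @\<^sub>v y" "x \<in> carrier_vec m" "y \<in> carrier_vec k"
    by (auto simp: orthocomplement_def elim: append_vec_cases)
  have eq: "x \<bullet>c a + y \<bullet>c b = 0" if "a \<in> A" "b \<in> B" for a b
  proof -
    have "v \<bullet>c (a @\<^sub>v b) = 0" using v that by (auto simp: orthocomplement_def vec_sum_def)
    then show ?thesis using xy that A B cscalar_prod_append[of x m a y k b]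
      by (auto simp: mem_subspaces_iff)
  qed
  \<comment> \<open>Zero lies in both subspaces, so setting one block of the test vector to zero
    separates the two summands of \<open>eq\<close>.\<close>
  have "x \<bullet>c a = 0" if "a \<in> A" for a
    using eq[OF that, of "0\<^sub>v k"] B xy by (simp add: mem_subspaces_iff)
  moreover have "y \<bullet>c b = 0" if "b \<in> B" for b
    using eq[OF _ that, of "0\<^sub>v m"] A xy by (simp add: mem_subspaces_iff)
  ultimately show "v \<in> vec_sum (orthocomplement m A) (orthocomplement k B)"
    using xy by (auto simp: vec_sum_def orthocomplement_def)
next
  fix v assume "v \<in> vec_sum (orthocomplement m A) (orthocomplement k B)"
  then show "v \<in> orthocomplement (m + k) (vec_sum A B)"
    using A B cscalar_prod_append[where m = m and k = k]
    by (auto simp: vec_sum_def orthocomplement_def mem_subspaces_iff subset_iff)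
qed

lemma span_Un_vec_sum:
  assumes sub: "A \<in> subspaces m" "A' \<in> subspaces m" "B \<in> subspaces k" "B' \<in> subspaces k"
  shows "LinearCombinations.module.span class_ring (Cn (m + k)) (vec_sum A B \<union> vec_sum A' B') =
    vec_sum (LinearCombinations.module.span class_ring (Cn m) (A \<union> A'))
      (LinearCombinations.module.span class_ring (Cn k) (B \<union> B'))"
proof -
  have add: "(a @\<^sub>v b) + (a' @\<^sub>v b') = (a + a') @\<^sub>v (b + b')"
    if "a \<in> A" "a' \<in> A'" "b \<in> B" "b' \<in> B'" for a b a' b'
    using append_vec_add[of a m a' b k b'] that sub by (auto simp: mem_subspaces_iff)
  have "{v + w | v w. v \<in> vec_sum A B \<and> w \<in> vec_sum A' B'} =
    {(a @\<^sub>v b) + (a' @\<^sub>v b') | a b a' b'. a \<in> A \<and> a' \<in> A' \<and> b \<in> B \<and> b' \<in> B'}"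
    unfolding vec_sum_def by blast
  also have "\<dots> = {(a + a') @\<^sub>v (b + b') | a b a' b'. a \<in> A \<and> a' \<in> A' \<and> b \<in> B \<and> b' \<in> B'}"
    using add by (intro Collect_cong) metis
  also have "\<dots> = vec_sum {a + a' | a a'. a \<in> A \<and> a' \<in> A'} {b + b' | b b'. b \<in> B \<and> b' \<in> B'}"
    unfolding vec_sum_def by blast
  finally show ?thesis using sub by (simp add: span_Un_subspaces vec_sum_in_subspaces)
qed

lemma valuation_vec_sum:
  assumes "\<And>i. S i \<in> subspaces m" "\<And>i. T i \<in> subspaces k"
  shows "valuation (m + k) \<phi> (\<lambda>i. vec_sum (S i) (T i)) =
    vec_sum (valuation m \<phi> S) (valuation k \<phi> T)"
  by (induction \<phi>)
    (simp_all add: assms valuation_in_subspaces vec_sum_carrier vec_sum_zero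
      vec_sum_Int[where m = m] orthocomplement_vec_sum span_Un_vec_sum)

lemma QL_antimono:
  assumes "m \<le> n"
  shows "QL n \<subseteq> QL m"
proof -
  have "\<not> tautology_in \<phi> n" if "\<not> tautology_in \<phi> m" for \<phi>
  proof -
    obtain k where n: "n = m + k" using assms le_Suc_ex by blast
    obtain S v where "\<forall>i. S i \<in> subspaces m" and v: "v \<in> valuation m \<phi> S" "v \<noteq> 0\<^sub>v m"
      using \<open>\<not> tautology_in \<phi> m\<close> by (rule not_tautology_inE)
    then have S: "S i \<in> subspaces m" for i by blast
    \<comment> \<open>Any assignment would do on the extra \<open>k\<close> coordinates: only
      membership of the zero vector in its value is used.\<close>
    let ?T = "\<lambda>_::nat. carrier_vec k :: complex vec set"
    have T: "?T i \<in> subspaces k" for i by (auto simp: mem_subspaces_iff)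
    have "0\<^sub>v k \<in> valuation k \<phi> ?T"
      using valuation_in_subspaces[of ?T k \<phi>] T by (simp add: mem_subspaces_iff)
    then have "v @\<^sub>v 0\<^sub>v k \<in> valuation n \<phi> (\<lambda>i. vec_sum (S i) (?T i))"
      using v unfolding n valuation_vec_sum[OF S T] by (auto simp: vec_sum_def)
    moreover have "v @\<^sub>v 0\<^sub>v k \<noteq> 0\<^sub>v n"
    proof
      assume "v @\<^sub>v 0\<^sub>v k = 0\<^sub>v n"
      then have "v @\<^sub>v 0\<^sub>v k \<in> vec_sum {0\<^sub>v m} {0\<^sub>v k}" by (simp add: n vec_sum_zero)
      moreover have "v \<in> carrier_vec m"
        using v valuation_in_subspaces[of S m \<phi>] S by (auto simp: mem_subspaces_iff)
      ultimately show False
        using v append_vec_eq[of v m "0\<^sub>v m" "0\<^sub>v k" "0\<^sub>v k"] by (auto simp: vec_sum_def)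
    qed
    ultimately show ?thesis
      using S T n by (intro not_tautology_inI[of "\<lambda>i. vec_sum (S i) (?T i)"])
        (auto intro: vec_sum_in_subspaces)
  qed
  then show ?thesis by (auto simp: QL_def)
qed


section \<open>The separating formula\<close>

text \<open>Nonzero pairwise orthogonal vectors are independent: pairing a vanishing linear
  combination with one of them isolates its coefficient.\<close>

lemma card_orthogonal_le:
  fixes u :: "nat \<Rightarrow> complex vec"
  assumes car: "\<And>i. i < n \<Longrightarrow> u i \<in> carrier_vec m" and nz: "\<And>i. i < n \<Longrightarrow> u i \<noteq> 0\<^sub>v m"
    and orth: "\<And>i j. i < n \<Longrightarrow> j < n \<Longrightarrow> i \<noteq> j \<Longrightarrow> u i \<bullet>c u j = 0"
  shows "n \<le> m"
proof -
  interpret V: vec_space "TYPE(complex)" m .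
  let ?A = "u ` {..<n}"
  have sq: "u i \<bullet>c u i \<noteq> 0" if "i < n" for i
    using car nz that conjugate_square_eq_0_vec by blast
  \<comment> \<open>A repeated vector would be orthogonal to itself, contradicting
    \<open>sq\<close>; hence the image really has \<open>n\<close> elements.\<close>
  have "inj_on u {..<n}"
    using sq orth by (metis inj_onI lessThan_iff)
  then have card: "card ?A = n" by (simp add: card_image)
  have A: "?A \<subseteq> carrier_vec m" using car by auto
  have "V.lin_indpt ?A"
  proof (rule V.finite_lin_indpt2)
    fix a :: "complex vec \<Rightarrow> complex" assume 0: "V.lincomb a ?A = 0\<^sub>v m"
    show "\<forall>w\<in>?A. a w = 0"
    proof
      fix w assume w: "w \<in> ?A"
      then have wc: "w \<in> carrier_vec m" using A by auto
      have "0 = V.lincomb a ?A \<bullet>c w" using wc 0 by simp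
      also have "\<dots> = (\<Sum>v\<in>?A. (a v \<cdot>\<^sub>v v) \<bullet>c w)"
        unfolding V.lincomb_def using A wc by (subst V.finsum_scalar_prod_sum) auto
      also have "\<dots> = (\<Sum>v\<in>?A. if v = w then a w * (w \<bullet>c w) else 0)"
      proof (rule sum.cong)
        fix v assume v: "v \<in> ?A"
        have "v \<bullet>c w = 0" if "v \<noteq> w" using v w that orth by auto
        then show "(a v \<cdot>\<^sub>v v) \<bullet>c w = (if v = w then a w * (w \<bullet>c w) else 0)"
          using v A wc by (auto simp: smult_scalar_prod_distrib[where n = m])
      qed simp
      also have "\<dots> = a w * (w \<bullet>c w)" using w by simp
      finally show "a w = 0" using w sq by auto
    qed
  qed (use A in auto)
  then show ?thesis using V.li_le_dim(2)[of ?A] A card V.dim_is_n by simp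
qed

text \<open>This is \<open>w\<^sub>i\<close>, with \<open>Var (Suc i)\<close> in the role of
  \<open>v\<^sub>i\<close>; the shift keeps \<open>Var 0\<close> free for \<open>x\<close>.\<close>

definition orthogonal_part :: "nat \<Rightarrow> formula" where
  "orthogonal_part i = foldr Meet (map (\<lambda>j. Neg (Var (Suc j))) [0..<i]) (Var (Suc i))"

definition separating :: "nat \<Rightarrow> formula" where
  "separating n = foldr Meet (map (\<lambda>i. Join (Neg (Var 0)) (orthogonal_part i)) [0..<n]) (Var 0)"

lemma mem_valuation_foldr_Meet:
  "v \<in> valuation n (foldr Meet \<phi>s \<psi>) S \<longleftrightarrow>
    v \<in> valuation n \<psi> S \<and> (\<forall>\<phi>\<in>set \<phi>s. v \<in> valuation n \<phi> S)"
  by (induction \<phi>s) auto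

lemma mem_valuation_orthogonal_part:
  "v \<in> valuation n (orthogonal_part i) S \<longleftrightarrow>
    v \<in> S (Suc i) \<and> (\<forall>j<i. v \<in> orthocomplement n (S (Suc j)))"
  by (auto simp: orthogonal_part_def mem_valuation_foldr_Meet)

text \<open>Each conjunct is a join of two subspaces, hence a decomposition of \<open>v\<close>. One
  direction extracts the orthogonal vectors in small dimension, the other certifies the explicit
  witness in C^n.\<close>

lemma mem_valuation_separating:
  assumes S: "\<And>i. S i \<in> subspaces n"
  shows "v \<in> valuation n (separating k) S \<longleftrightarrow> v \<in> S 0 \<and>
    (\<forall>i<k. \<exists>a b. v = a + b \<and> a \<in> orthocomplement n (S 0) \<and>
      b \<in> valuation n (orthogonal_part i) S)"
proof -
  have "orthocomplement n (S 0) \<in> subspaces n"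
    using S[of 0] by (intro orthocomplement_in_subspaces) (simp add: mem_subspaces_iff)
  then show ?thesis
    using S by (auto simp: separating_def mem_valuation_foldr_Meet span_Un_subspaces
        valuation_in_subspaces)
qed

lemma separating_tautology:
  assumes "m < n"
  shows "tautology_in (separating n) m"
proof (rule ccontr)
  assume "\<not> tautology_in (separating n) m"
  then obtain S v where "\<forall>i. S i \<in> subspaces m"
    and v: "v \<in> valuation m (separating n) S" "v \<noteq> 0\<^sub>v m"
    by (rule not_tautology_inE)
  then have S: "S i \<in> subspaces m" for i by blast
  have car: "S i \<subseteq> carrier_vec m" for i using S[of i] by (simp add: mem_subspaces_iff)
  have v0: "v \<in> S 0" using v S by (simp add: mem_valuation_separating)
  have "\<exists>u. u \<in> valuation m (orthogonal_part i) S \<and> u \<noteq> 0\<^sub>v m" if i: "i < n" for i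
  proof -
    obtain a b where ab: "v = a + b" "a \<in> orthocomplement m (S 0)"
      "b \<in> valuation m (orthogonal_part i) S"
      using v(1) i unfolding mem_valuation_separating[OF S] by blast
    have "b \<noteq> 0\<^sub>v m"
    proof
      assume "b = 0\<^sub>v m"
      then have "v \<in> orthocomplement m (S 0)" using ab by (auto simp: orthocomplement_def)
      then have "v \<bullet>c v = 0" using v0 by (simp add: orthocomplement_def)
      then show False using v v0 car[of 0] conjugate_square_eq_0_vec[of v m] by blast
    qed
    then show ?thesis using ab by blast
  qed
  then obtain u where u: "\<And>i. i < n \<Longrightarrow> u i \<in> valuation m (orthogonal_part i) S"
    "\<And>i. i < n \<Longrightarrow> u i \<noteq> 0\<^sub>v m"
    by metis
  have uc: "u i \<in> carrier_vec m" if "i < n" for i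
    using u(1)[OF that] car by (auto simp: mem_valuation_orthogonal_part)
  \<comment> \<open>The later vector \<open>u j\<close> lies in the complement of
    \<open>S (Suc i)\<close>, which contains \<open>u i\<close>. The formula gives orthogonality in
    this order only; conjugate symmetry then supplies the other.\<close>
  have less: "u j \<bullet>c u i = 0" if "i < j" "j < n" for i j
    using u(1)[of i] u(1)[of j] that by (auto simp: mem_valuation_orthogonal_part orthocomplement_def)
  have "u i \<bullet>c u j = 0" if "i < j" "j < n" for i j
  proof -
    have "u i \<bullet>c u j = conjugate (u j \<bullet>c u i)"
      using that uc conjugate_vec_sprod_comm[of "u i" m "u j"]
        conjugate_sprod_vec[of "u j" m "conjugate (u i)"] by simp
    then show ?thesis using less[OF that] by simp
  qed
  then have "u i \<bullet>c u j = 0" if "i < n" "j < n" "i \<noteq> j" for i j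
    using less that by (cases i j rule: linorder_cases) auto
  then have "n \<le> m" using u uc by (intro card_orthogonal_le[of n u])
  then show False using assms by simp
qed

lemma separating_not_tautology:
  assumes "0 < n"
  shows "\<not> tautology_in (separating n) n"
proof -
  define line where "line u = range (\<lambda>c. c \<cdot>\<^sub>v u)" for u :: "complex vec"
  define s :: "complex vec" where "s = vec n (\<lambda>_. 1)"
  define S where "S i = (case i of 0 \<Rightarrow> line s | Suc j \<Rightarrow> line (unit_vec n j))" for i
  have self: "u \<in> line u" for u by (auto simp: line_def intro!: image_eqI[of _ _ 1])
  have s: "s \<in> carrier_vec n" by (simp add: s_def)
  have line: "line u \<in> subspaces n" if "u \<in> carrier_vec n" for u
    using that by (auto simp: mem_subspaces_iff line_def smult_smult_assoc
        add_smult_distrib_vec[symmetric] intro!: image_eqI[of "0\<^sub>v n" _ 0])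
  have S: "S i \<in> subspaces n" for i using s by (auto simp: S_def line split: nat.split)
  have orth: "v \<in> orthocomplement n (line u)"
    if "v \<in> carrier_vec n" "u \<in> carrier_vec n" "v \<bullet>c u = 0" for u v
    using that by (auto simp: orthocomplement_def line_def conjugate_smult_vec)
  have "\<exists>a b. s = a + b \<and> a \<in> orthocomplement n (S 0) \<and> b \<in> valuation n (orthogonal_part i) S"
    if i: "i < n" for i
  proof (intro exI conjI)
    \<comment> \<open>The factor \<open>n\<close> is forced by orthogonality of
      \<open>s - ?b\<close> to \<open>s\<close>: the square of \<open>s\<close> is \<open>n\<close>,
      while its product with a unit vector is 1.\<close>
    let ?b = "of_nat n \<cdot>\<^sub>v unit_vec n i :: complex vec"
    show "s = (s - ?b) + ?b" by (rule eq_vecI) (auto simp: s_def)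
    \<comment> \<open>The entries of \<open>s\<close> are real, so the Hermitian product against
      \<open>s\<close> reduces to the bilinear one.\<close>
    have "conjugate s = s" by (rule eq_vecI) (auto simp: s_def)
    moreover have "s \<bullet> s = of_nat n" by (simp add: s_def scalar_prod_def)
    moreover have "unit_vec n i \<bullet> s = 1" using i s by (simp add: s_def)
    ultimately have "(s - ?b) \<bullet>c s = 0"
      using s by (simp add: minus_scalar_prod_distrib[where n = n])
    then show "s - ?b \<in> orthocomplement n (S 0)" using s by (auto simp: S_def intro!: orth)
    have "?b \<in> orthocomplement n (line (unit_vec n j))" if "j < i" for j
      using i that by (intro orth) (auto simp: conjugate_vec_def)
    then show "?b \<in> valuation n (orthogonal_part i) S"
      by (auto simp: mem_valuation_orthogonal_part S_def line_def)
  qed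
  then have "s \<in> valuation n (separating n) S"
    using S self[of s] by (simp add: mem_valuation_separating) (simp add: S_def)
  moreover have "s \<noteq> 0\<^sub>v n"
  proof
    assume "s = 0\<^sub>v n"
    \<comment> \<open>Coordinate 0 exists because \<open>0 < n\<close>; in C^0 the vector
      \<open>s\<close> would itself be zero.\<close>
    then have "s $ 0 = 0" using assms by simp
    then show False using assms by (simp add: s_def)
  qed
  ultimately show ?thesis using S by (intro not_tautology_inI)
qed

theorem theorem1:
  fixes m n :: nat
  assumes "m < n"
  shows "QL n \<subset> QL m"
proof -
  \<comment> \<open>The index is the larger dimension \<open>n\<close>, and \<open>m < n\<close>
    also yields the positivity needed for the nonzero value.\<close>
  have "separating n \<in> QL m" "separating n \<notin> QL n"
    using assms separating_tautology separating_not_tautology by (auto simp: QL_def)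
  then show ?thesis using QL_antimono[of m n] assms by auto
qed

end
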